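(* Let $p$ be a prime. The series $\sum_{n=0}^{\infty} p^{v_p(n!)}$ converges in $\mathbb{Z}_p$, and the $p$-adic expansion of its sum is not (eventually) periodic.
   Context: $\mathbb{Z}_p$ is the ring of $p$-adic integers. For a positive integer $m$, $v_p(m)$ denotes the exponent of the highest power of $p$ dividing $m$. The $p$-adic expansion of $\alpha \in \mathbb{Z}_p$ is the unique digit sequence $(a_i)_{i\ge 0}$ with $a_i \in \{0,\dots,p-1\}$ and $\alpha = \sum_{i\ge0} a_i p^i$; it is called periodic if the sequence $(a_i)$ is eventually periodic. *)

theory Defs
  imports "HOL-Analysis.Analysis" "HOL-Algebra.Ring" "HOL-Computational_Algebra.Primes"
begin

text \<open>
  \<open>\<int>\<^sub>p\<close> as the inverse limit of the rings \<open>\<int>/p\<^sup>n\<int>\<close>: an element is a sequence \<open>x\<close> whose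
  entry \<open>x n\<close> is the representative in \<open>{0..<p\<^sup>n}\<close> of its class modulo \<open>p\<^sup>n\<close>.
\<close>

definition padic_int :: "nat \<Rightarrow> (nat \<Rightarrow> int) ring" where
  "padic_int p =
    \<lparr>carrier = {x. \<forall>n. x n \<in> {0..<int p ^ n} \<and> x (Suc n) mod int p ^ n = x n},
     monoid.mult = (\<lambda>x y n. (x n * y n) mod int p ^ n),
     one = (\<lambda>n. 1 mod int p ^ n),
     zero = (\<lambda>n. 0),
     add = (\<lambda>x y n. (x n + y n) mod int p ^ n)\<rparr>"

definition padic_of_int :: "nat \<Rightarrow> int \<Rightarrow> nat \<Rightarrow> int" where
  "padic_of_int p k = (\<lambda>n. k mod int p ^ n)"

text \<open>
  Since \<open>x \<in> p\<^sup>n\<int>\<^sub>p\<close> iff \<open>x n = 0\<close>, the valuation of \<open>x \<noteq> 0\<close> is the least \<open>n\<close> with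
  \<open>x (n + 1) \<noteq> 0\<close>.
\<close>

definition padic_val :: "(nat \<Rightarrow> int) \<Rightarrow> nat" where
  "padic_val x = (LEAST n. x (Suc n) \<noteq> 0)"

definition padic_norm :: "nat \<Rightarrow> (nat \<Rightarrow> int) \<Rightarrow> real" where
  "padic_norm p x = (if x = \<zero>\<^bsub>padic_int p\<^esub> then 0 else (1 / real p) ^ padic_val x)"

text \<open>The value off the carrier is irrelevant; \<open>0\<close> meets the totality demands of \<open>Metric_space\<close>.\<close>

definition padic_dist :: "nat \<Rightarrow> (nat \<Rightarrow> int) \<Rightarrow> (nat \<Rightarrow> int) \<Rightarrow> real" where
  "padic_dist p x y =
    (if x \<in> carrier (padic_int p) \<and> y \<in> carrier (padic_int p)
     then padic_norm p (x \<ominus>\<^bsub>padic_int p\<^esub> y) else 0)"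

definition padic_topology :: "nat \<Rightarrow> (nat \<Rightarrow> int) topology" where
  "padic_topology p = Metric_space.mtopology (carrier (padic_int p)) (padic_dist p)"

definition padic_sums :: "nat \<Rightarrow> (nat \<Rightarrow> nat \<Rightarrow> int) \<Rightarrow> (nat \<Rightarrow> int) \<Rightarrow> bool" where
  "padic_sums p f s \<longleftrightarrow>
    limitin (padic_topology p) (\<lambda>N. finsum (padic_int p) f {..<N}) s sequentially"

definition is_padic_expansion :: "nat \<Rightarrow> (nat \<Rightarrow> nat) \<Rightarrow> (nat \<Rightarrow> int) \<Rightarrow> bool" where
  "is_padic_expansion p a x \<longleftrightarrow>
    (\<forall>i. a i \<in> {0..p - 1}) \<and> padic_sums p (\<lambda>i. padic_of_int p (int (a i) * int p ^ i)) x"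

text \<open>Existence and uniqueness of the expansion are proved in \<open>is_padic_expansion_ex1\<close> below.\<close>

definition padic_expansion :: "nat \<Rightarrow> (nat \<Rightarrow> int) \<Rightarrow> nat \<Rightarrow> nat" where
  "padic_expansion p x = (THE a. is_padic_expansion p a x)"

definition eventually_periodic :: "(nat \<Rightarrow> 'a) \<Rightarrow> bool" where
  "eventually_periodic a \<longleftrightarrow> (\<exists>N. \<exists>k>0. \<forall>i\<ge>N. a (i + k) = a i)"


lemma padic_carrier_iff:
  assumes "p > 0"
  shows "x \<in> carrier (padic_int p) \<longleftrightarrow> (\<forall>n. x (Suc n) mod int p ^ n = x n)"
proof -
  have "x n \<in> {0..<int p ^ n}" if "x (Suc n) mod int p ^ n = x n" for n
    unfolding that[symmetric] using assms by simp
  then show ?thesis by (auto simp: padic_int_def)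
qed

lemma padic_mod_self:
  assumes "x \<in> carrier (padic_int p)"
  shows "x n mod int p ^ n = x n"
  using assms by (auto simp: padic_int_def)

lemma padic_mod_le:
  assumes "x \<in> carrier (padic_int p)" "m \<le> n"
  shows "x n mod int p ^ m = x m"
  using assms(2)
proof (induction n rule: dec_induct)
  case base
  show ?case using assms(1) by (rule padic_mod_self)
next
  case (step n)
  have "int p ^ m dvd int p ^ n" using step by (simp add: le_imp_power_dvd)
  then have "x (Suc n) mod int p ^ m = (x (Suc n) mod int p ^ n) mod int p ^ m"
    by (simp add: mod_mod_cancel)
  also have "x (Suc n) mod int p ^ n = x n" using assms(1) by (auto simp: padic_int_def)
  finally show ?case using step by simp
qed

lemma mod_Suc_power_mod: "(k mod int p ^ Suc n) mod int p ^ n = k mod int p ^ n"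
  by (rule mod_mod_cancel) (simp add: le_imp_power_dvd)

lemma padic_of_int_closed [simp]:
  assumes "p > 0"
  shows "padic_of_int p k \<in> carrier (padic_int p)"
  unfolding padic_carrier_iff[OF assms] padic_of_int_def using mod_Suc_power_mod by blast

lemma padic_simps:
  "\<zero>\<^bsub>padic_int p\<^esub> = (\<lambda>n. 0)"
  "\<one>\<^bsub>padic_int p\<^esub> = (\<lambda>n. 1 mod int p ^ n)"
  "x \<oplus>\<^bsub>padic_int p\<^esub> y = (\<lambda>n. (x n + y n) mod int p ^ n)"
  "x \<otimes>\<^bsub>padic_int p\<^esub> y = (\<lambda>n. (x n * y n) mod int p ^ n)"
  by (simp_all add: padic_int_def)

lemma padic_closed:
  assumes "p > 0" "x \<in> carrier (padic_int p)" "y \<in> carrier (padic_int p)"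
  shows "(\<lambda>n. (x n + y n) mod int p ^ n) \<in> carrier (padic_int p)"
    and "(\<lambda>n. (x n * y n) mod int p ^ n) \<in> carrier (padic_int p)"
    and "(\<lambda>n. (x n - y n) mod int p ^ n) \<in> carrier (padic_int p)"
proof -
  have *: "x (Suc n) mod int p ^ n = x n" "y (Suc n) mod int p ^ n = y n" for n
    using assms(2,3) unfolding padic_carrier_iff[OF assms(1)] by blast+
  show "(\<lambda>n. (x n + y n) mod int p ^ n) \<in> carrier (padic_int p)"
    unfolding padic_carrier_iff[OF assms(1)] mod_Suc_power_mod
    using * mod_add_eq[of "x (Suc n)" "int p ^ n" "y (Suc n)" for n] by simp
  show "(\<lambda>n. (x n * y n) mod int p ^ n) \<in> carrier (padic_int p)"
    unfolding padic_carrier_iff[OF assms(1)] mod_Suc_power_mod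
    using * mod_mult_eq[of "x (Suc n)" "int p ^ n" "y (Suc n)" for n] by simp
  show "(\<lambda>n. (x n - y n) mod int p ^ n) \<in> carrier (padic_int p)"
    unfolding padic_carrier_iff[OF assms(1)] mod_Suc_power_mod
    using * mod_diff_eq[of "x (Suc n)" "int p ^ n" "y (Suc n)" for n] by simp
qed

lemma padic_zero_closed:
  assumes "p > 0"
  shows "(\<lambda>n. 0) \<in> carrier (padic_int p)"
  by (simp add: padic_carrier_iff[OF assms])

theorem padic_int_cring:
  assumes "p > 0"
  shows "cring (padic_int p)"
proof (rule cringI)
  show "abelian_group (padic_int p)"
  proof (rule abelian_groupI)
    fix x assume x: "x \<in> carrier (padic_int p)"
    show "\<exists>y\<in>carrier (padic_int p). y \<oplus>\<^bsub>padic_int p\<^esub> x = \<zero>\<^bsub>padic_int p\<^esub>"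
    proof
      show "(\<lambda>n. (0 - x n) mod int p ^ n) \<in> carrier (padic_int p)"
        using padic_closed(3)[OF assms padic_zero_closed[OF assms] x] .
      show "(\<lambda>n. (0 - x n) mod int p ^ n) \<oplus>\<^bsub>padic_int p\<^esub> x = \<zero>\<^bsub>padic_int p\<^esub>"
        by (simp add: padic_simps mod_simps)
    qed
  qed (simp_all add: padic_simps padic_closed[OF assms] padic_zero_closed[OF assms]
      padic_mod_self mod_simps ac_simps)
  show "comm_monoid (padic_int p)"
  proof (rule comm_monoidI)
    show "\<one>\<^bsub>padic_int p\<^esub> \<in> carrier (padic_int p)"
      using padic_of_int_closed[OF assms, of 1] by (simp add: padic_simps padic_of_int_def)
  qed (simp_all add: padic_simps padic_closed[OF assms] padic_mod_self mod_simps ac_simps)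
qed (simp add: padic_simps mod_simps distrib_right)

lemma padic_minus:
  assumes "p > 0" "x \<in> carrier (padic_int p)" "y \<in> carrier (padic_int p)"
  shows "x \<ominus>\<^bsub>padic_int p\<^esub> y = (\<lambda>n. (x n - y n) mod int p ^ n)"
proof -
  interpret cring "padic_int p" by (rule padic_int_cring[OF assms(1)])
  let ?d = "\<lambda>n. (x n - y n) mod int p ^ n"
  have d: "?d \<in> carrier (padic_int p)" using padic_closed(3)[OF assms] .
  have "?d \<oplus>\<^bsub>padic_int p\<^esub> y = x"
    using padic_mod_self[OF assms(2)] by (simp add: padic_simps mod_simps)
  moreover have "(?d \<oplus>\<^bsub>padic_int p\<^esub> y) \<ominus>\<^bsub>padic_int p\<^esub> y = ?d"
    using d assms(3) by (simp add: a_minus_def a_assoc r_neg)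
  ultimately show ?thesis by simp
qed

lemma padic_norm_le_iff:
  assumes p: "p > 1" and x: "x \<in> carrier (padic_int p)"
  shows "padic_norm p x \<le> (1 / real p) ^ k \<longleftrightarrow> x k = 0"
proof (cases "x = \<zero>\<^bsub>padic_int p\<^esub>")
  case True
  then show ?thesis by (simp add: padic_norm_def padic_simps)
next
  case False
  have x0: "x 0 = 0" using padic_mod_self[OF x, of 0] by simp
  obtain m where "x m \<noteq> 0" using False by (auto simp: padic_simps)
  with x0 have "\<exists>n. x (Suc n) \<noteq> 0" by (metis not0_implies_Suc)
  then have v: "x (Suc (padic_val x)) \<noteq> 0"
    unfolding padic_val_def by (rule LeastI_ex)
  have small: "x (Suc j) = 0" if "j < padic_val x" for j
    using not_less_Least[of j "\<lambda>n. x (Suc n) \<noteq> 0"] that unfolding padic_val_def by blast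
  have "k \<le> padic_val x \<longleftrightarrow> x k = 0"
  proof
    show "x k = 0" if "k \<le> padic_val x"
      using that small x0 by (cases k) auto
    show "k \<le> padic_val x" if "x k = 0"
    proof (rule ccontr)
      assume "\<not> k \<le> padic_val x"
      then have "x k mod int p ^ Suc (padic_val x) = x (Suc (padic_val x))"
        by (intro padic_mod_le[OF x]) simp
      then show False using that v by simp
    qed
  qed
  moreover have "(1 / real p) ^ padic_val x \<le> (1 / real p) ^ k \<longleftrightarrow> k \<le> padic_val x"
    using p by (intro power_decreasing_iff) auto
  ultimately show ?thesis using False by (simp add: padic_norm_def)
qed

lemma padic_dist_le_iff:
  assumes "p > 1" "x \<in> carrier (padic_int p)" "y \<in> carrier (padic_int p)"
  shows "padic_dist p x y \<le> (1 / real p) ^ k \<longleftrightarrow> x k = y k"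
proof -
  have p0: "p > 0" using assms(1) by simp
  have "(x k - y k) mod int p ^ k = 0 \<longleftrightarrow> x k mod int p ^ k = y k mod int p ^ k"
    by (simp add: mod_eq_dvd_iff mod_eq_0_iff_dvd)
  then show ?thesis
    using assms(2,3) padic_norm_le_iff[OF assms(1) padic_closed(3)[OF p0 assms(2,3)], of k]
    by (simp add: padic_dist_def padic_minus[OF p0] padic_mod_self)
qed

lemma padic_dist_cases:
  "padic_dist p x y = 0 \<or> (\<exists>k. padic_dist p x y = (1 / real p) ^ k)"
  by (auto simp: padic_dist_def padic_norm_def)

theorem padic_Metric_space:
  assumes p: "p > 1"
  shows "Metric_space (carrier (padic_int p)) (padic_dist p)"
proof
  have p0: "p > 0" using p by simp
  have pos: "(1 / real p) ^ k > 0" for k using p by simp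
  show nn: "0 \<le> padic_dist p x y" for x y
    by (simp add: padic_dist_def padic_norm_def)
  show comm: "padic_dist p x y = padic_dist p y x" for x y
  proof -
    have le: "padic_dist p x y \<le> padic_dist p y x" 
      if "x \<in> carrier (padic_int p)" "y \<in> carrier (padic_int p)" for x y
    proof (cases "padic_dist p y x = 0")
      case True
      then have "y k = x k" for k
        using padic_dist_le_iff[OF p that(2,1), of k] pos[of k] by simp
      then have "x = y" by auto
      then show ?thesis using True by simp
    next
      case False
      then obtain k where "padic_dist p y x = (1 / real p) ^ k"
        using padic_dist_cases by blast
      then show ?thesis
        using padic_dist_le_iff[OF p that, of k] padic_dist_le_iff[OF p that(2,1), of k] by simp
    qed
    show ?thesis
    proof (cases "x \<in> carrier (padic_int p) \<and> y \<in> carrier (padic_int p)")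
      case True
      then show ?thesis using le[of x y] le[of y x] by simp
    qed (auto simp: padic_dist_def)
  qed
  show zero: "padic_dist p x y = 0 \<longleftrightarrow> x = y"
    if "x \<in> carrier (padic_int p)" "y \<in> carrier (padic_int p)" for x y
  proof
    assume "padic_dist p x y = 0"
    then have "x k = y k" for k
      using padic_dist_le_iff[OF p that, of k] pos[of k] by simp
    then show "x = y" by auto
  next
    assume "x = y"
    then show "padic_dist p x y = 0"
      using that by (simp add: padic_dist_def padic_minus[OF p0] padic_norm_def padic_simps)
  qed
  show "padic_dist p x z \<le> padic_dist p x y + padic_dist p y z"
    if x: "x \<in> carrier (padic_int p)" and y: "y \<in> carrier (padic_int p)"
      and z: "z \<in> carrier (padic_int p)" for x y z
  proof -
    let ?m = "max (padic_dist p x y) (padic_dist p y z)"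
    have "padic_dist p x z \<le> ?m"
    proof (cases "?m = 0")
      case True
      then have "padic_dist p x y = 0" "padic_dist p y z = 0"
        using nn[of x y] nn[of y z] by (auto simp: max_def split: if_splits)
      then show ?thesis using zero x y z True by simp
    next
      case False
      then obtain k where k: "?m = (1 / real p) ^ k"
        using padic_dist_cases[of p x y] padic_dist_cases[of p y z]
        by (auto simp: max_def split: if_splits)
      have "padic_dist p x y \<le> (1 / real p) ^ k" "padic_dist p y z \<le> (1 / real p) ^ k"
        unfolding k[symmetric] by simp_all
      then show ?thesis
        unfolding k by (simp add: padic_dist_le_iff[OF p] x y z)
    qed
    then show ?thesis using nn[of x y] nn[of y z] by linarith
  qed
qed

lemma padic_limitin_iff:
  assumes p: "p > 1" and f: "\<And>n. f n \<in> carrier (padic_int p)"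
  shows "limitin (padic_topology p) f s sequentially \<longleftrightarrow>
    s \<in> carrier (padic_int p) \<and> (\<forall>k. \<forall>\<^sub>F n in sequentially. f n k = s k)"
proof -
  interpret Metric_space "carrier (padic_int p)" "padic_dist p"
    by (rule padic_Metric_space[OF p])
  have "(\<forall>\<epsilon>>0. \<forall>\<^sub>F n in sequentially. padic_dist p (f n) s < \<epsilon>) \<longleftrightarrow>
      (\<forall>k. \<forall>\<^sub>F n in sequentially. f n k = s k)" if s: "s \<in> carrier (padic_int p)"
  proof safe
    fix k
    assume "\<forall>\<epsilon>>0. \<forall>\<^sub>F n in sequentially. padic_dist p (f n) s < \<epsilon>"
    then have "\<forall>\<^sub>F n in sequentially. padic_dist p (f n) s < (1 / real p) ^ k"
      using p by simp
    then show "\<forall>\<^sub>F n in sequentially. f n k = s k"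
    proof eventually_elim
      case (elim n)
      then show ?case using padic_dist_le_iff[OF p f s, of n k] by simp
    qed
  next
    fix \<epsilon> :: real
    assume ev: "\<forall>k. \<forall>\<^sub>F n in sequentially. f n k = s k" and "\<epsilon> > 0"
    then obtain k where k: "(1 / real p) ^ k < \<epsilon>"
      using real_arch_pow_inv[of \<epsilon> "1 / real p"] p by auto
    have "\<forall>\<^sub>F n in sequentially. f n k = s k" using ev by blast
    then show "\<forall>\<^sub>F n in sequentially. padic_dist p (f n) s < \<epsilon>"
    proof eventually_elim
      case (elim n)
      then have "padic_dist p (f n) s \<le> (1 / real p) ^ k"
        using padic_dist_le_iff[OF p f s] by simp
      then show ?case using k by simp
    qed
  qed
  then show ?thesis
    unfolding padic_topology_def limitin_metric using f by auto
qed

lemma padic_finsum_of_int: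
  fixes N :: nat
  assumes "p > 0"
  shows "finsum (padic_int p) (\<lambda>i. padic_of_int p (c i)) {..<N} = padic_of_int p (\<Sum>i<N. c i)"
proof -
  interpret cring "padic_int p" by (rule padic_int_cring[OF assms])
  show ?thesis
  proof (induction N)
    case 0
    then show ?case by (simp add: padic_of_int_def padic_simps)
  next
    case (Suc N)
    have "finsum (padic_int p) (\<lambda>i. padic_of_int p (c i)) {..<Suc N} =
        padic_of_int p (c N) \<oplus>\<^bsub>padic_int p\<^esub> finsum (padic_int p) (\<lambda>i. padic_of_int p (c i)) {..<N}"
      unfolding lessThan_Suc by (rule finsum_insert) (use assms in auto)
    then show ?case
      unfolding Suc by (simp add: padic_of_int_def padic_simps mod_simps add.commute)
  qed
qed

lemma padic_sums_of_int_iff: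
  assumes p: "p > 1"
  shows "padic_sums p (\<lambda>i. padic_of_int p (c i)) s \<longleftrightarrow>
    s \<in> carrier (padic_int p) \<and>
    (\<forall>k. \<forall>\<^sub>F N in sequentially. (\<Sum>i<N. c i) mod int p ^ k = s k)"
proof -
  have p0: "p > 0" using p by simp
  have "padic_sums p (\<lambda>i. padic_of_int p (c i)) s \<longleftrightarrow>
      limitin (padic_topology p) (\<lambda>N. padic_of_int p (\<Sum>i<N. c i)) s sequentially"
    by (simp add: padic_sums_def padic_finsum_of_int[OF p0])
  also have "\<dots> \<longleftrightarrow> s \<in> carrier (padic_int p) \<and>
      (\<forall>k. \<forall>\<^sub>F N in sequentially. padic_of_int p (\<Sum>i<N. c i) k = s k)"
    using p0 by (intro padic_limitin_iff[OF p]) simp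
  finally show ?thesis by (simp add: padic_of_int_def)
qed

lemma is_padic_expansion_iff:
  assumes p: "p > 1" and x: "x \<in> carrier (padic_int p)"
  shows "is_padic_expansion p a x \<longleftrightarrow>
    (\<forall>i. a i < p) \<and> (\<forall>k. (\<Sum>i<k. int (a i) * int p ^ i) = x k)"
proof -
  have step: "(\<Sum>i<N. int (a i) * int p ^ i) mod int p ^ k =
      (\<Sum>i<k. int (a i) * int p ^ i) mod int p ^ k" if "k \<le> N" for k N
    using that
  proof (induction N rule: dec_induct)
    case (step N)
    have "int p ^ k dvd int (a N) * int p ^ N"
      using step by (simp add: le_imp_power_dvd)
    then have "(\<Sum>i<Suc N. int (a i) * int p ^ i) mod int p ^ k =
        (\<Sum>i<N. int (a i) * int p ^ i) mod int p ^ k"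
      unfolding sum.lessThan_Suc by (simp only: mod_eq_dvd_iff) simp
    then show ?case unfolding step.IH .
  qed (rule refl)
  have range: "(\<Sum>i<k. int (a i) * int p ^ i) \<in> {0..<int p ^ k}" if a: "\<forall>i. a i < p" for k
  proof (induction k)
    case (Suc k)
    have "int (a k) \<le> int p - 1" using a[rule_format, of k] by simp
    then have "int (a k) * int p ^ k \<le> (int p - 1) * int p ^ k"
      by (intro mult_right_mono) auto
    then show ?case using Suc by (auto simp: algebra_simps)
  qed simp
  have "(\<forall>\<^sub>F N in sequentially. (\<Sum>i<N. int (a i) * int p ^ i) mod int p ^ k = x k) \<longleftrightarrow>
      (\<Sum>i<k. int (a i) * int p ^ i) = x k" if a: "\<forall>i. a i < p" for k
  proof -
    have "(\<forall>\<^sub>F N in sequentially. (\<Sum>i<N. int (a i) * int p ^ i) mod int p ^ k = x k) \<longleftrightarrow>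
        (\<forall>\<^sub>F N in sequentially. (\<Sum>i<k. int (a i) * int p ^ i) mod int p ^ k = x k)"
    proof (intro eventually_subst eventually_sequentiallyI)
      fix N assume "k \<le> N"
      show "((\<Sum>i<N. int (a i) * int p ^ i) mod int p ^ k = x k) =
          ((\<Sum>i<k. int (a i) * int p ^ i) mod int p ^ k = x k)"
        unfolding step[OF \<open>k \<le> N\<close>] ..
    qed
    also have "\<dots> \<longleftrightarrow> (\<Sum>i<k. int (a i) * int p ^ i) mod int p ^ k = x k"
      by simp
    finally show ?thesis using range[OF a, of k] by simp
  qed
  moreover have "a i \<in> {0..p - 1} \<longleftrightarrow> a i < p" for i
    using p by auto
  ultimately show ?thesis
    unfolding is_padic_expansion_def padic_sums_of_int_iff[OF p] using x by auto
qed

theorem is_padic_expansion_ex1: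
  assumes p: "p > 1" and x: "x \<in> carrier (padic_int p)"
  shows "\<exists>!a. is_padic_expansion p a x"
proof (rule ex_ex1I)
  define a where "a i = nat (x (Suc i) div int p ^ i)" for i
  have xr: "0 \<le> x k" "x k < int p ^ k" "x (Suc k) mod int p ^ k = x k" for k
    using x by (auto simp: padic_int_def)
  have a: "int (a i) = x (Suc i) div int p ^ i" for i
    using p xr(1)[of "Suc i"] by (simp add: a_def pos_imp_zdiv_nonneg_iff)
  have "a i < p" for i
  proof -
    have "x (Suc i) < int p * int p ^ i" using xr(2)[of "Suc i"] by simp
    moreover have "x (Suc i) div int p ^ i * int p ^ i \<le> x (Suc i)"
      using p div_mult_mod_eq[of "x (Suc i)" "int p ^ i"] zero_less_power[of "int p" i]
        pos_mod_sign[of "int p ^ i" "x (Suc i)"] by linarith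
    ultimately have "x (Suc i) div int p ^ i * int p ^ i < int p * int p ^ i" by simp
    then have "x (Suc i) div int p ^ i < int p" using p by simp
    then show ?thesis using a[of i] by linarith
  qed
  moreover have "(\<Sum>i<k. int (a i) * int p ^ i) = x k" for k
  proof (induction k)
    case 0
    then show ?case using xr(1,2)[of 0] by simp
  next
    case (Suc k)
    then show ?case
      using div_mult_mod_eq[of "x (Suc k)" "int p ^ k"] xr(3)[of k] by (simp add: a)
  qed
  ultimately show "\<exists>a. is_padic_expansion p a x"
    unfolding is_padic_expansion_iff[OF p x] by blast
next
  fix a b
  assume "is_padic_expansion p a x" "is_padic_expansion p b x"
  then have *: "(\<Sum>i<k. int (a i) * int p ^ i) = x k" "(\<Sum>i<k. int (b i) * int p ^ i) = x k" for k
    unfolding is_padic_expansion_iff[OF p x] by blast+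
  show "a = b"
  proof
    fix i
    have "int (a i) * int p ^ i = int (b i) * int p ^ i"
      using *[of i] *[of "Suc i"] unfolding sum.lessThan_Suc by linarith
    then show "a i = b i" using p by simp
  qed
qed

end

theory Submission
  imports Defs
begin

text \<open>
  Write \<open>v n\<close> for the exponent of \<open>p\<close> in \<open>n!\<close> and \<open>A\<^sub>k\<close> for the sum of the terms with
  \<open>n < p\<^sup>k\<close>. The exponents \<open>v n\<close> are constant on blocks of length \<open>p\<close> and strictly increase from
  one block to the next, so \<open>A\<^sub>k\<close> is at most \<open>p\<^sup>2\<close> times its last term; but \<open>v\<close> jumps by at least
  \<open>k\<close> at \<open>n = p\<^sup>k\<close>. Hence \<open>A\<^sub>k\<close> is the truncation of the sum at position \<open>v (p\<^sup>k)\<close>, and the last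
  \<open>k - 3\<close> digits before that position vanish. A periodic expansion with zero runs of unbounded
  length is finally zero, which contradicts that the truncations \<open>A\<^sub>k\<close> keep growing.
\<close>

section \<open>Truncations of p-adic series of integers, digits and zero runs\<close>

lemma sum_mod_stable:
  fixes c :: "nat \<Rightarrow> int"
  assumes c: "\<And>i. M \<le> i \<Longrightarrow> d dvd c i" and "M \<le> N"
  shows "(\<Sum>i<N. c i) mod d = (\<Sum>i<M. c i) mod d"
  using assms(2)
proof (induction N rule: dec_induct)
  case (step N)
  from c[OF step(1)] have "(\<Sum>i<Suc N. c i) mod d = (\<Sum>i<N. c i) mod d"
    unfolding sum.lessThan_Suc by (simp only: mod_eq_dvd_iff) simp
  then show ?case using step.IH by simp
qed simp

lemma padic_sums_ex:
  assumes p: "p > 1" and c: "\<And>k i. M k \<le> i \<Longrightarrow> int p ^ k dvd c i"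
  shows "\<exists>s \<in> carrier (padic_int p). padic_sums p (\<lambda>i. padic_of_int p (c i)) s"
proof -
  define s where "s k = (\<Sum>i<M k. c i) mod int p ^ k" for k
  have stable: "(\<Sum>i<N. c i) mod int p ^ k = s k" if "M k \<le> N" for k N
    unfolding s_def using c that by (rule sum_mod_stable)
  have "s (Suc k) mod int p ^ k = s k" for k
  proof -
    let ?N = "max (M k) (M (Suc k))"
    have "s (Suc k) mod int p ^ k = ((\<Sum>i<?N. c i) mod int p ^ Suc k) mod int p ^ k"
      using stable[of "Suc k" ?N] by simp
    also have "\<dots> = s k" using stable[of k ?N] by (simp only: mod_Suc_power_mod max.cobounded1)
    finally show ?thesis .
  qed
  then have "s \<in> carrier (padic_int p)" using p by (simp add: padic_carrier_iff)
  moreover have "\<forall>\<^sub>F N in sequentially. (\<Sum>i<N. c i) mod int p ^ k = s k" for k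
    using stable by (rule eventually_sequentiallyI)
  ultimately show ?thesis using padic_sums_of_int_iff[OF p] by blast
qed

text \<open>The tail vanishes modulo \<open>p ^ k\<close>; \<open>range\<close> makes the partial
  sum its own residue, which turns the congruence into an equality.\<close>

lemma padic_sums_truncation:
  assumes p: "p > 1" and s: "padic_sums p (\<lambda>i. padic_of_int p (c i)) s"
    and c: "\<And>i. M \<le> i \<Longrightarrow> int p ^ k dvd c i"
    and range: "(\<Sum>i<M. c i) \<in> {0..<int p ^ k}"
  shows "s k = (\<Sum>i<M. c i)"
proof -
  have stable: "(\<Sum>i<N. c i) mod int p ^ k = (\<Sum>i<M. c i) mod int p ^ k" if "M \<le> N" for N
    using c that by (rule sum_mod_stable)
  have "\<forall>\<^sub>F N in sequentially. (\<Sum>i<N. c i) mod int p ^ k = s k"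
    using s unfolding padic_sums_of_int_iff[OF p] by blast
  then obtain N0 where "\<And>N. N0 \<le> N \<Longrightarrow> (\<Sum>i<N. c i) mod int p ^ k = s k"
    unfolding eventually_sequentially by blast
  from this[of "max M N0"] stable[of "max M N0"] range show ?thesis by simp
qed

lemma digit_eq_0_if_sum_less:
  fixes a :: "nat \<Rightarrow> nat"
  assumes "(\<Sum>i<n. int (a i) * int p ^ i) < int p ^ j" "j \<le> i" "i < n" "p > 0"
  shows "a i = 0"
proof (rule ccontr)
  assume "a i \<noteq> 0"
  then have "int p ^ i \<le> int (a i) * int p ^ i" using assms(4) by simp
  also have "\<dots> \<le> (\<Sum>i<n. int (a i) * int p ^ i)"
    using assms(3) by (intro member_le_sum) auto
  also have "\<dots> < int p ^ j" by fact
  finally show False using assms(2,4) power_increasing[of j i "int p"] by simp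
qed

text \<open>Stepping back by \<open>q\<close> from any later index eventually lands in the run,
  which covers a full period.\<close>

lemma periodic_zero_run:
  fixes a :: "nat \<Rightarrow> 'a::zero"
  assumes per: "\<And>i. N \<le> i \<Longrightarrow> a (i + q) = a i" and "q > 0" "N \<le> j"
    and run: "\<And>i. j \<le> i \<Longrightarrow> i < j + q \<Longrightarrow> a i = 0" and "j \<le> i"
  shows "a i = 0"
  using \<open>j \<le> i\<close>
proof (induction i rule: less_induct)
  case (less i)
  show ?case
  proof (cases "i < j + q")
    case True
    then show ?thesis using run less.prems by simp
  next
    case False
    then have "a (i - q) = 0" using \<open>q > 0\<close> by (intro less.IH) auto
    moreover have "a (i - q + q) = a (i - q)" using False \<open>N \<le> j\<close> by (intro per) simp
    ultimately show ?thesis using False by simp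
  qed
qed

section \<open>The exponent of \<open>p\<close> in factorials\<close>

lemma multiplicity_fact_mono:
  assumes "prime (p::nat)" "m \<le> n"
  shows "multiplicity p (fact m) \<le> multiplicity p (fact n)"
  using assms by (intro dvd_imp_multiplicity_le fact_dvd) auto

lemma multiplicity_fact_block:
  assumes "prime (p::nat)" "r < p"
  shows "multiplicity p (fact (p * m + r)) = multiplicity p (fact (p * m))"
  using assms(2)
proof (induction r)
  case (Suc r)
  have "\<not> p dvd Suc r" using Suc.prems by (auto dest: dvd_imp_le)
  then have "\<not> p dvd p * m + Suc r" by (metis dvd_add_right_iff dvd_triv_left)
  then have "multiplicity p (Suc (p * m + r)) = 0" by (simp add: not_dvd_imp_multiplicity_0)
  moreover have "multiplicity p (fact (Suc (p * m + r)) :: nat) =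
      multiplicity p (Suc (p * m + r)) + multiplicity p (fact (p * m + r))"
    unfolding fact_Suc of_nat_id
    using assms(1) by (intro prime_elem_multiplicity_mult_distrib) auto
  ultimately show ?case using Suc by simp
qed simp

text \<open>The factor \<open>n\<close> of \<open>fact n\<close> comes on top of
  \<open>fact (n - 1)\<close>, which \<open>fact m\<close> divides.\<close>

lemma multiplicity_fact_jump:
  assumes "prime (p::nat)" "m < n"
  shows "multiplicity p n + multiplicity p (fact m) \<le> multiplicity p (fact n)"
proof -
  obtain n' where n: "n = Suc n'" "m \<le> n'" using assms(2) by (cases n) auto
  have "multiplicity p (fact n :: nat) = multiplicity p n + multiplicity p (fact n')"
    unfolding n fact_Suc of_nat_id
    using assms(1) by (intro prime_elem_multiplicity_mult_distrib) auto
  then show ?thesis using multiplicity_fact_mono[OF assms(1) n(2)] by simp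
qed

lemma multiplicity_fact_next_block:
  assumes "prime (p::nat)"
  shows "Suc (multiplicity p (fact (p * m))) \<le> multiplicity p (fact (p * Suc m))"
proof -
  have p: "p > 1" using assms by (rule prime_gt_1_nat)
  then have "multiplicity p (p * Suc m) \<ge> 1"
    by (intro multiplicity_geI) (auto simp del: mult_Suc_right)
  then show ?thesis
    using multiplicity_fact_jump[OF assms, of "p * m" "p * Suc m"] p by simp
qed

lemma multiplicity_fact_ge:
  assumes "prime (p::nat)"
  shows "m \<le> multiplicity p (fact (p * m))"
proof (induction m)
  case (Suc m)
  then show ?case using multiplicity_fact_next_block[OF assms, of m] by linarith
qed simp

section \<open>Size of the partial sums\<close>

lemma sum_block:
  fixes f :: "nat \<Rightarrow> nat"
  assumes "\<And>r. r < p \<Longrightarrow> f (p * m + r) = f (p * m)"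
  shows "(\<Sum>n<p * Suc m. f n) = (\<Sum>n<p * m. f n) + p * f (p * m)"
proof -
  have "(\<Sum>n<p * m + r. f n) = (\<Sum>n<p * m. f n) + r * f (p * m)" if "r \<le> p" for r
    using that assms by (induction r) auto
  from this[of p] show ?thesis by (simp add: add.commute)
qed

text \<open>With \<open>e\<close> the exponent on the new block, the earlier sum is at most
  \<open>p ^ (1 + e)\<close> because the exponent has risen, and the new block adds exactly
  \<open>p ^ (1 + e)\<close>. The resulting factor 2 is absorbed by \<open>p\<close>.\<close>

lemma sum_power_multiplicity_fact_le:
  assumes "prime (p::nat)"
  shows "(\<Sum>n<p * Suc m. p ^ multiplicity p (fact n)) \<le> p ^ (2 + multiplicity p (fact (p * m)))"
proof (induction m)
  case 0
  have "(\<Sum>n<p * Suc 0. p ^ multiplicity p (fact n)) = p"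
    using sum_block[of p "\<lambda>n. p ^ multiplicity p (fact n)" 0]
      multiplicity_fact_block[OF assms, of _ 0] by simp
  then show ?case using prime_gt_0_nat[OF assms] by (simp add: power2_eq_square)
next
  case (Suc m)
  let ?v = "\<lambda>n. multiplicity p (fact n :: nat)"
  have p: "p > 1" using assms by (rule prime_gt_1_nat)
  have "(\<Sum>n<p * Suc (Suc m). p ^ ?v n) = (\<Sum>n<p * Suc m. p ^ ?v n) + p * p ^ ?v (p * Suc m)"
    by (rule sum_block) (simp only: multiplicity_fact_block[OF assms])
  also have "\<dots> \<le> p ^ (2 + ?v (p * m)) + p * p ^ ?v (p * Suc m)"
    using Suc by simp
  also have "p ^ (2 + ?v (p * m)) \<le> p ^ (1 + ?v (p * Suc m))"
    using multiplicity_fact_next_block[OF assms, of m] p by (intro power_increasing) auto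
  also have "p ^ (1 + ?v (p * Suc m)) + p * p ^ ?v (p * Suc m) = 2 * (p * p ^ ?v (p * Suc m))"
    by simp
  also have "\<dots> \<le> p * (p * p ^ ?v (p * Suc m))"
    using p by (intro mult_right_mono) auto
  also have "\<dots> = p ^ (2 + ?v (p * Suc m))" by (simp add: power_add power2_eq_square)
  finally show ?case by simp
qed

text \<open>The bound \<open>k \<le> j\<close> will push the zero run past any preperiod. The second
  bound comes from the jump by \<open>Suc k\<close> at \<open>p ^ Suc k\<close> and leaves room for
  at least \<open>k - 2\<close> zero digits from position \<open>j\<close> on.\<close>

lemma sum_power_multiplicity_fact_less:
  assumes "prime (p::nat)"
  obtains j where "k \<le> j" "j + k \<le> multiplicity p (fact (p ^ Suc k)) + 2"
    "(\<Sum>n<p ^ Suc k. p ^ multiplicity p (fact n)) < p ^ j"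
proof
  let ?v = "\<lambda>n. multiplicity p (fact n :: nat)"
  have p: "p > 1" using assms by (rule prime_gt_1_nat)
  \<comment> \<open>\<open>p * m\<close> starts the last block below \<open>p ^ Suc k\<close>. The
    witness for \<open>j\<close> is \<open>3 + ?v (p * m)\<close>: 2 from the bound on the sum, 1 to
    make it strict.\<close>
  define m where "m = p ^ k - 1"
  have m: "Suc m = p ^ k" using p by (simp add: m_def)
  have "k < p ^ k" using p power_gt_expt[of p k] by simp
  then have "k \<le> m" by (simp add: m_def)
  then show "k \<le> 3 + ?v (p * m)" using multiplicity_fact_ge[OF assms, of m] by simp
  have "multiplicity p (p ^ Suc k) = Suc k"
    using assms p by (intro multiplicity_same_power) auto
  moreover have "p * m < p ^ Suc k" using p by (simp add: m[symmetric])
  ultimately have "Suc k + ?v (p * m) \<le> ?v (p ^ Suc k)"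
    using multiplicity_fact_jump[OF assms, of "p * m" "p ^ Suc k"] by simp
  then show "3 + ?v (p * m) + k \<le> ?v (p ^ Suc k) + 2" by simp
  have "(\<Sum>n<p ^ Suc k. p ^ ?v n) \<le> p ^ (2 + ?v (p * m))"
    using sum_power_multiplicity_fact_le[OF assms, of m] unfolding m by simp
  also have "\<dots> < p ^ (3 + ?v (p * m))" using p by (intro power_strict_increasing) auto
  finally show "(\<Sum>n<p ^ Suc k. p ^ ?v n) < p ^ (3 + ?v (p * m))" .
qed

theorem theorem3:
  fixes p :: nat
  assumes "prime p"
  shows "\<exists>s \<in> carrier (padic_int p).
    padic_sums p (\<lambda>n. padic_of_int p (int (p ^ multiplicity p (fact n)))) s \<and>
    \<not> eventually_periodic (padic_expansion p s)"
proof -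
  let ?v = "\<lambda>n. multiplicity p (fact n :: nat)"
  let ?A = "\<lambda>k. \<Sum>n<p ^ Suc k. p ^ ?v n"
  let ?E = "\<lambda>k. ?v (p ^ Suc k)"
  have p: "p > 1" using assms by (rule prime_gt_1_nat)
  have dvd: "int p ^ k dvd int (p ^ ?v i)" if "k \<le> ?v i" for k i
    using that by (simp add: le_imp_power_dvd)
  \<comment> \<open>The modulus of convergence is \<open>p * k\<close>, as each of the first
    \<open>k\<close> multiples of \<open>p\<close> contributes a factor \<open>p\<close>.\<close>
  have "int p ^ k dvd int (p ^ ?v i)" if "p * k \<le> i" for k i
    using multiplicity_fact_ge[OF assms, of k] multiplicity_fact_mono[OF assms that]
    by (intro dvd) simp
  then obtain s where s: "s \<in> carrier (padic_int p)"
    and sums: "padic_sums p (\<lambda>n. padic_of_int p (int (p ^ ?v n))) s"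
    using padic_sums_ex[OF p, of "\<lambda>k. p * k" "\<lambda>n. int (p ^ ?v n)"] by blast
  define a where "a = padic_expansion p s"
  have "is_padic_expansion p a s"
    unfolding a_def padic_expansion_def using is_padic_expansion_ex1[OF p s] by (rule theI')
  then have digits: "(\<Sum>i<k. int (a i) * int p ^ i) = s k" for k
    unfolding is_padic_expansion_iff[OF p s] by blast
  have trunc: "s (?E k) = int (?A k)" if "k \<ge> 2" for k
  proof -
    obtain j where j: "j + k \<le> ?E k + 2" "?A k < p ^ j"
      using sum_power_multiplicity_fact_less[OF assms] by metis
    \<comment> \<open>Here \<open>k \<ge> 2\<close> gives \<open>j \<le> ?E k\<close>.\<close>
    have "p ^ j \<le> p ^ ?E k" using p j(1) that by (intro power_increasing) auto
    with j(2) have "int (?A k) < int (p ^ ?E k)" by linarith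
    moreover have "int p ^ ?E k dvd int (p ^ ?v i)" if "p ^ Suc k \<le> i" for i
      using multiplicity_fact_mono[OF assms that] by (rule dvd)
    ultimately have "s (?E k) = (\<Sum>n<p ^ Suc k. int (p ^ ?v n))"
      by (intro padic_sums_truncation[OF p sums]) (auto simp: sum_nonneg)
    then show ?thesis by simp
  qed
  have "\<not> eventually_periodic a"
  proof
    assume "eventually_periodic a"
    then obtain N q where q: "q > 0" and per: "\<And>i. N \<le> i \<Longrightarrow> a (i + q) = a i"
      unfolding eventually_periodic_def by blast
    \<comment> \<open>\<open>N\<close> puts \<open>j\<close> past the preperiod. Since
      \<open>j + k \<le> ?E k + 2\<close>, the rest gives \<open>j + q \<le> ?E k\<close>, so a
      whole period of zeros fits below \<open>?E k\<close>; the 2 also makes \<open>trunc\<close>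
      applicable.\<close>
    define k where "k = N + q + 2"
    obtain j where j: "k \<le> j" "j + k \<le> ?E k + 2" "?A k < p ^ j"
      using sum_power_multiplicity_fact_less[OF assms] by metis
    have "int (?A k) < int (p ^ j)" using j(3) by linarith
    then have "(\<Sum>i<?E k. int (a i) * int p ^ i) < int p ^ j"
      unfolding digits using trunc[of k] by (simp add: k_def)
    then have run: "a i = 0" if "j \<le> i" "i < j + q" for i
      using that j(2) p by (intro digit_eq_0_if_sum_less[of a p "?E k"]) (auto simp: k_def)
    have zero: "a i = 0" if "j \<le> i" for i
      using per q _ run that by (rule periodic_zero_run) (use j(1) in \<open>auto simp: k_def\<close>)
    have less: "p ^ Suc k < p ^ Suc (Suc k)" using p by (intro power_strict_increasing) auto
    have "?E k \<le> ?E (Suc k)"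
      using less by (intro multiplicity_fact_mono[OF assms]) simp
    \<comment> \<open>No nonzero digit is left between the two truncation positions, so the
      truncations agree, although the later partial sum has further positive terms.\<close>
    then have "(\<Sum>i<?E k. int (a i) * int p ^ i) = (\<Sum>i<?E (Suc k). int (a i) * int p ^ i)"
      using j(2) by (intro sum.mono_neutral_left) (auto simp: k_def intro!: zero)
    then have "int (?A k) = int (?A (Suc k))"
      unfolding digits using trunc[of k] trunc[of "Suc k"] by (simp only: k_def le_add2 le_SucI)
    then have "?A k = ?A (Suc k)" by (rule of_nat_eq_iff[THEN iffD1])
    moreover have "?A k < ?A (Suc k)"
      using less p by (intro sum_strict_mono2[of _ _ "p ^ Suc k"]) auto
    ultimately show False by simp
  qed
  then show ?thesis using s sums unfolding a_def by blast
qed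

end
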